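(* Let $G$ be a finite, simple, connected graph which is neither a path graph nor an extended star graph. Then for every integer $k\geq 1$, $G$ is circularly $k$-partite if and only if $k$ divides $\chi^o(G)$.
   Context: All graphs are finite, simple (undirected, no loops, no multi-edges) and connected. A path graph is a graph consisting of a single path. An extended star graph is a tree with exactly one vertex of degree $\geq3$. An oriented edge $[v,w]$ is an edge $\{v,w\}$ with input $v$ and output $w$; $\mathcal{O}=\{[v,w],[w,v]: v\sim w\}$. For $k\geq 1$, $G$ is circularly $k$-partite if $\mathcal{O}$ can be partitioned as $\mathcal{O}=\mathcal{O}_1\sqcup\cdots\sqcup\mathcal{O}_k$ with all $\mathcal{O}_j$ non-empty and such that $[v,w]\in\mathcal{O}_j$ implies $[w,z]\in\mathcal{O}_{j+1}$ for every $z\sim w$ with $z\neq v$, indices modulo $k$. The oriented edge periodic colouring number $\chi^o(G)$ is the largest $k$ such that $G$ is circularly $k$-partite. *)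

theory Defs
  imports
    "HOL-Library.Disjoint_Sets"
    "Graph_Theory.Pair_Digraph"
    "Graph_Theory.Digraph_Component"
begin

text \<open>
  A finite simple graph is a \<^locale>\<open>pair_graph\<close>, i.e. a finite symmetric loop-free relation on
  its vertices. Each edge \<open>{v, w}\<close> is thus represented by the two arcs \<open>(v, w)\<close> and \<open>(w, v)\<close>, so
  \<^term>\<open>parcs G\<close> is exactly the set of oriented edges.
\<close>

text \<open>A single vertex is a path graph.\<close>

definition path_graph :: "'a pair_pre_digraph \<Rightarrow> bool" where
  "path_graph G \<longleftrightarrow> (\<exists>u p v. pre_digraph.apath (with_proj G) u p v \<and>
     pverts G = set (pawalk_verts u p) \<and> parcs G = set p \<union> (set p)\<inverse>)"

text \<open>
  \<^const>\<open>pre_digraph.cycle\<close> also counts the closed walk \<open>v, w, v\<close> along a single edge as a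
  cycle, so the library's \<open>tree\<close> is not usable for symmetric digraphs. In a simple
  graph, the genuine cycles are those of length at least 3.
\<close>

definition tree_graph :: "'a pair_pre_digraph \<Rightarrow> bool" where
  "tree_graph G \<longleftrightarrow> Digraph_Component.connected (with_proj G) \<and>
     \<not> (\<exists>p. pre_digraph.cycle (with_proj G) p \<and> length p \<ge> 3)"

text \<open>By symmetry, the out-degree of a vertex is its number of neighbours.\<close>

definition extended_star_graph :: "'a pair_pre_digraph \<Rightarrow> bool" where
  "extended_star_graph G \<longleftrightarrow> tree_graph G \<and>
     (\<exists>!v. v \<in> pverts G \<and> out_degree (with_proj G) v \<ge> 3)"

text \<open>The classes are indexed by \<open>0, \<dots>, k - 1\<close>.\<close>

definition circularly_partite :: "'a pair_pre_digraph \<Rightarrow> nat \<Rightarrow> bool" where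
  "circularly_partite G k \<longleftrightarrow> k \<ge> 1 \<and>
     (\<exists>P :: nat \<Rightarrow> ('a \<times> 'a) set.
        (\<Union>j<k. P j) = parcs G \<and> disjoint_family_on P {..<k} \<and> (\<forall>j<k. P j \<noteq> {}) \<and>
        (\<forall>j<k. \<forall>v w z. (v, w) \<in> P j \<longrightarrow> (w, z) \<in> parcs G \<longrightarrow> z \<noteq> v
            \<longrightarrow> (w, z) \<in> P ((j + 1) mod k)))"

definition chi_o :: "'a pair_pre_digraph \<Rightarrow> nat" where
  "chi_o G = Max {k. circularly_partite G k}"

text \<open>The maximum is over a finite set, which is nonempty as soon as the graph has an edge.\<close>

lemma finite_circularly_partite:
  assumes "finite (parcs G)"
  shows "finite {k. circularly_partite G k}"
proof (rule finite_subset)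
  show "{k. circularly_partite G k} \<subseteq> {..card (parcs G)}"
  proof
    fix k assume "k \<in> {k. circularly_partite G k}"
    then obtain P :: "nat \<Rightarrow> ('a \<times> 'a) set" where
      P: "(\<Union>j<k. P j) = parcs G" "disjoint_family_on P {..<k}" "\<forall>j<k. P j \<noteq> {}"
      by (auto simp: circularly_partite_def)
    define f where "f j = (SOME e. e \<in> P j)" for j
    have f: "\<forall>j<k. f j \<in> P j"
      using P(3) by (simp add: f_def some_in_eq)
    have "inj_on f {..<k}"
    proof (rule inj_onI)
      fix i j assume ij: "i \<in> {..<k}" "j \<in> {..<k}" "f i = f j"
      then have "f i \<in> P i \<inter> P j"
        using f by (metis IntI lessThan_iff)
      then show "i = j"
        using P(2) ij(1,2) unfolding disjoint_family_on_def by blast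
    qed
    moreover have "f ` {..<k} \<subseteq> parcs G"
      using f P(1) by blast
    ultimately show "k \<in> {..card (parcs G)}"
      using card_inj_on_le[of f "{..<k}" "parcs G"] assms by simp
  qed
qed simp

lemma circularly_partite_1:
  assumes "parcs G \<noteq> {}"
  shows "circularly_partite G 1"
  unfolding circularly_partite_def using assms
  by (intro conjI exI[of _ "\<lambda>_. parcs G"]) (simp_all add: disjoint_family_on_def lessThan_Suc)

end

theory Submission
  imports Defs "HOL-Number_Theory.Cong"
begin

text \<open>
  A circular \<open>k\<close>-partition is a surjective map \<open>c\<close> from the arcs to the residues modulo \<open>k\<close> which
  increases by one along every non-backtracking step. By the Chinese remainder theorem, such maps
  modulo coprime \<open>k\<close> and \<open>m\<close> combine to one modulo \<open>k * m\<close>, and they can be reduced modulo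
  divisors. Hence, surjectivity aside, the admissible \<open>k\<close> are the divisors of the largest one.

  At a vertex of degree at least 3 all incoming arcs have the same class and all outgoing arcs the
  next one, so \<open>c\<close> also increases by one along a backtracking step there. If the graph has a cycle, or
  two vertices of degree at least 3, then infinite walks exist that backtrack at vertices of degree
  at least 3 only, which makes every \<open>c\<close> surjective. The remaining graphs are paths and
  extended stars.
\<close>

section \<open>Labellings by residues\<close>

text \<open>Surjectivity is left out, so that the notion passes to divisors and to coprime products.
  Integer values compared by congruence let one \<open>c\<close> serve for several moduli.\<close>

definition circular_labelling :: "'a pair_pre_digraph \<Rightarrow> nat \<Rightarrow> ('a \<times> 'a \<Rightarrow> int) \<Rightarrow> bool" where
  "circular_labelling G k c \<longleftrightarrow>
     (\<forall>v w z. (v, w) \<in> parcs G \<longrightarrow> (w, z) \<in> parcs G \<longrightarrow> z \<noteq> v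
        \<longrightarrow> [c (w, z) = c (v, w) + 1] (mod int k))"

lemma circular_labellingD:
  assumes "circular_labelling G k c" "(v, w) \<in> parcs G" "(w, z) \<in> parcs G" "z \<noteq> v"
  shows "[c (w, z) = c (v, w) + 1] (mod int k)"
  using assms unfolding circular_labelling_def by blast

lemma circularly_partite_imp_labelling:
  assumes "circularly_partite G k"
  shows "\<exists>c. circular_labelling G k c"
proof -
  obtain P :: "nat \<Rightarrow> ('a \<times> 'a) set" where
    P: "(\<Union>j<k. P j) = parcs G" "disjoint_family_on P {..<k}"
    and step: "\<And>j v w z. j < k \<Longrightarrow> (v, w) \<in> P j \<Longrightarrow> (w, z) \<in> parcs G \<Longrightarrow> z \<noteq> v
      \<Longrightarrow> (w, z) \<in> P ((j + 1) mod k)"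
    using assms unfolding circularly_partite_def by metis
  have "\<forall>e\<in>parcs G. \<exists>j. j < k \<and> e \<in> P j"
    using P(1) by auto
  then obtain f where f: "\<And>e. e \<in> parcs G \<Longrightarrow> f e < k \<and> e \<in> P (f e)"
    by metis
  have "circular_labelling G k (\<lambda>e. int (f e))"
    unfolding circular_labelling_def
  proof (intro allI impI)
    fix v w z assume vwz: "(v, w) \<in> parcs G" "(w, z) \<in> parcs G" "z \<noteq> v"
    let ?j = "(f (v, w) + 1) mod k"
    have "f (v, w) < k" "(v, w) \<in> P (f (v, w))"
      using f[OF vwz(1)] by auto
    then have "(w, z) \<in> P ?j" "?j < k"
      using step vwz by auto
    with f[OF vwz(2)] have "f (w, z) = ?j"
      using P(2) unfolding disjoint_family_on_def by blast
    then have "[f (w, z) = f (v, w) + 1] (mod k)"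
      by (simp add: cong_def)
    then show "[int (f (w, z)) = int (f (v, w)) + 1] (mod int k)"
      by (metis cong_int_iff of_nat_1 of_nat_add)
  qed
  then show ?thesis by blast
qed

lemma circular_labelling_dvd:
  assumes "circular_labelling G k c" "m dvd k"
  shows "circular_labelling G m c"
  using assms unfolding circular_labelling_def
  by (meson cong_dvd_modulus int_dvd_int_iff)

lemma circular_labelling_mult:
  assumes c: "circular_labelling G k c" and d: "circular_labelling G m d" and "coprime k m"
  shows "\<exists>f. circular_labelling G (k * m) f"
proof -
  have cop: "coprime (int k) (int m)"
    using assms(3) by simp
  have "\<forall>e. \<exists>x. [x = c e] (mod int k) \<and> [x = d e] (mod int m)"
    using binary_chinese_remainder_int[OF cop] by blast
  then obtain f where f: "\<And>e. [f e = c e] (mod int k)" "\<And>e. [f e = d e] (mod int m)"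
    by metis
  have "circular_labelling G (k * m) f"
    unfolding circular_labelling_def
  proof (intro allI impI)
    fix v w z assume vwz: "(v, w) \<in> parcs G" "(w, z) \<in> parcs G" "z \<noteq> v"
    have "[f (w, z) = f (v, w) + 1] (mod int k)"
      using circular_labellingD[OF c vwz] f(1) by (meson cong_add cong_refl cong_sym cong_trans)
    moreover have "[f (w, z) = f (v, w) + 1] (mod int m)"
      using circular_labellingD[OF d vwz] f(2) by (meson cong_add cong_refl cong_sym cong_trans)
    ultimately show "[f (w, z) = f (v, w) + 1] (mod int (k * m))"
      using cop by (simp add: coprime_cong_mult)
  qed
  then show ?thesis by blast
qed

section \<open>Recurrent sets of arcs\<close>

text \<open>A finite substitute for an infinite walk: since every arc can be continued inside
  \<open>X\<close>, walks of any length grow from any arc of \<open>X\<close> by induction.\<close>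

definition recurrent_arcs :: "'a pair_pre_digraph \<Rightarrow> ('a \<times> 'a) set \<Rightarrow> bool" where
  "recurrent_arcs G X \<longleftrightarrow> X \<noteq> {} \<and> X \<subseteq> parcs G \<and>
     (\<forall>(v, w)\<in>X. \<exists>z. (w, z) \<in> X \<and> (z \<noteq> v \<or> out_degree (with_proj G) w \<ge> 3))"

context pair_graph
begin

lemma card_neighbours: "card {z. (w, z) \<in> parcs G} = out_degree (with_proj G) w"
proof -
  have "out_arcs (with_proj G) w = Pair w ` {z. (w, z) \<in> parcs G}"
    by (auto simp: out_arcs_def)
  then show ?thesis
    by (simp add: out_degree_def card_image inj_on_def)
qed

lemma finite_neighbours: "finite {z. (w, z) \<in> parcs G}"
  by (rule finite_subset[OF _ pair_finite_verts]) (auto dest: in_arcsD2)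

text \<open>Take two further neighbours \<open>a\<close>, \<open>b\<close> of \<open>w\<close>. The
  genuine steps from \<open>(b, w)\<close> to \<open>(w, v)\<close>, from \<open>(b, w)\<close> to
  \<open>(w, a)\<close> and from \<open>(v, w)\<close> to \<open>(w, a)\<close> link the two
  labels.\<close>

lemma circular_labelling_backtrack:
  assumes c: "circular_labelling G k c" and vw: "(v, w) \<in> parcs G"
    and deg: "out_degree (with_proj G) w \<ge> 3"
  shows "[c (w, v) = c (v, w) + 1] (mod int k)"
proof -
  let ?N = "{z. (w, z) \<in> parcs G} - {v}"
  have "card ?N \<ge> 2"
    using deg finite_neighbours[of w]
    by (auto simp: card_neighbours card_Diff_singleton_if)
  then obtain a b where ab: "a \<in> ?N" "b \<in> ?N" "a \<noteq> b"
    by (auto simp: card_le_Suc_iff numeral_2_eq_2)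
  then have bw: "(b, w) \<in> parcs G"
    using arcs_symmetric by auto
  have "[c (w, v) = c (b, w) + 1] (mod int k)"
    using circular_labellingD[OF c bw, of v] ab arcs_symmetric[OF vw] by auto
  moreover have "[c (w, a) = c (b, w) + 1] (mod int k)"
    using circular_labellingD[OF c bw, of a] ab by auto
  moreover have "[c (w, a) = c (v, w) + 1] (mod int k)"
    using circular_labellingD[OF c vw, of a] ab by auto
  ultimately show ?thesis
    by (meson cong_sym cong_trans)
qed

text \<open>Following a walk inside \<open>X\<close>, the label grows by one at each step and so
  runs through all residues.\<close>

lemma circular_labelling_surj:
  assumes c: "circular_labelling G k c" and X: "recurrent_arcs G X" and k: "k \<ge> 1"
  shows "\<exists>e\<in>parcs G. [c e = j] (mod int k)"
proof -
  obtain e0 where e0: "e0 \<in> X"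
    using X unfolding recurrent_arcs_def by blast
  have walk: "\<exists>e\<in>X. [c e = c e0 + int n] (mod int k)" for n
  proof (induction n)
    case 0
    show ?case using e0 by (intro bexI[of _ e0]) simp_all
  next
    case (Suc n)
    then obtain v w where vw: "(v, w) \<in> X" "[c (v, w) = c e0 + int n] (mod int k)"
      by auto
    then obtain z where z: "(w, z) \<in> X" "z \<noteq> v \<or> out_degree (with_proj G) w \<ge> 3"
      using X unfolding recurrent_arcs_def by blast
    have "(v, w) \<in> parcs G" "(w, z) \<in> parcs G"
      using X vw(1) z(1) unfolding recurrent_arcs_def by auto
    then have "[c (w, z) = c (v, w) + 1] (mod int k)"
      using circular_labelling_backtrack[OF c] circular_labellingD[OF c] z(2) by blast
    then have "[c (w, z) = c e0 + int n + 1] (mod int k)"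
      using vw(2) by (meson cong_add cong_refl cong_trans)
    with z(1) show ?case
      by (auto simp: ac_simps)
  qed
  \<comment> \<open>The number of steps from \<open>e0\<close> after which the label is
    \<open>j\<close> modulo \<open>k\<close>.\<close>
  define n where "n = nat ((j - c e0) mod int k)"
  have "int n = (j - c e0) mod int k"
    using k by (simp add: n_def)
  then have "[c e0 + int n = j] (mod int k)"
    by (simp add: cong_def mod_simps)
  with walk[of n] show ?thesis
    using X unfolding recurrent_arcs_def by (meson cong_trans subsetD)
qed

lemma circularly_partite_iff_labelling:
  assumes X: "recurrent_arcs G X" and k: "k \<ge> 1"
  shows "circularly_partite G k \<longleftrightarrow> (\<exists>c. circular_labelling G k c)"
proof
  assume "\<exists>c. circular_labelling G k c"
  then obtain c where c: "circular_labelling G k c" ..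
  \<comment> \<open>The classes are the fibres of \<open>c\<close> modulo \<open>k\<close>;
    \<open>circular_labelling_surj\<close> makes them non-empty.\<close>
  define P where "P j = {e \<in> parcs G. c e mod int k = int j}" for j
  have "(\<Union>j<k. P j) = parcs G"
  proof
    show "parcs G \<subseteq> (\<Union>j<k. P j)"
    proof
      fix e assume "e \<in> parcs G"
      then have "e \<in> P (nat (c e mod int k))" "nat (c e mod int k) < k"
        using k by (simp_all add: P_def nat_less_iff)
      then show "e \<in> (\<Union>j<k. P j)" by blast
    qed
  qed (auto simp: P_def)
  moreover have "disjoint_family_on P {..<k}"
    by (auto simp: disjoint_family_on_def P_def)
  moreover have "P j \<noteq> {}" if "j < k" for j
    using circular_labelling_surj[OF c X k, of "int j"] that by (auto simp: P_def cong_def)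
  moreover have "(w, z) \<in> P ((j + 1) mod k)"
    if "(v, w) \<in> P j" "(w, z) \<in> parcs G" "z \<noteq> v" "j < k" for j v w z
  proof -
    have "(v, w) \<in> parcs G" "[c (v, w) = int j] (mod int k)"
      using that(1,4) by (auto simp: P_def cong_def)
    then have "[c (w, z) = int j + 1] (mod int k)"
      using circular_labellingD[OF c _ that(2,3)] by (meson cong_add cong_refl cong_trans)
    with that(2) show ?thesis
      by (simp add: P_def cong_def of_nat_mod add.commute)
  qed
  ultimately show "circularly_partite G k"
    using k unfolding circularly_partite_def by (intro conjI exI[of _ P]) blast+
qed (rule circularly_partite_imp_labelling)

section \<open>Paths and cycles\<close>

text \<open>The arc \<open>(v, w)\<close> closes \<open>q\<close> to a cycle of length at least 3,
  on which going round never backtracks.\<close>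

lemma recurrent_closed_path:
  assumes q: "apath w q v" and len: "length q \<ge> 2" and vw: "(v, w) \<in> parcs G"
  shows "recurrent_arcs G (insert (v, w) (set q))"
proof -
  obtain x r where r: "q = (w, x) # r" "r \<noteq> []"
    using q len by (cases q) (fastforce simp: apath_Cons_iff)+
  have "apath x r v" "w \<noteq> v" "w \<notin> set (pawalk_verts x r)"
    using q r apath_nonempty_ends[OF q] by (auto simp: apath_Cons_iff)
  have "x \<noteq> v"
    using \<open>apath x r v\<close> r(2) apath_nonempty_ends by blast
  have "\<exists>z. (b, z) \<in> insert (v, w) (set q) \<and> z \<noteq> a" if ab: "(a, b) \<in> insert (v, w) (set q)" for a b
  proof (cases "(a, b) = (v, w)")
    case True
    then show ?thesis using r \<open>x \<noteq> v\<close> by auto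
  next
    case False
    then have "(a, b) \<in> set q" using ab by auto
    show ?thesis
    \<comment> \<open>An arc into \<open>v\<close> is continued by \<open>(v, w)\<close>. This would
      backtrack only if \<open>a = w\<close>, but the arc lies on \<open>r\<close>, which avoids
      \<open>w\<close>.\<close>
    proof (cases "b = v")
      case True
      then have "(a, b) \<in> set r"
        using \<open>(a, b) \<in> set q\<close> r \<open>x \<noteq> v\<close> by auto
      then have "a \<noteq> w"
        using \<open>w \<notin> set (pawalk_verts x r)\<close> awalk_verts_arc1[of "(a, b)" r x] by auto
      with True show ?thesis by auto
    next
      case False
      from apath_succ_decomp[OF q \<open>(a, b) \<in> set q\<close> this] show ?thesis
        by force
    qed
  qed
  moreover have "set q \<subseteq> parcs G"
    using q by (auto simp: apath_def)
  ultimately show ?thesis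
    using vw unfolding recurrent_arcs_def by fast
qed

lemma recurrent_cycle:
  assumes "cycle p" "length p \<ge> 3"
  shows "\<exists>X. recurrent_arcs G X"
proof -
  obtain u where u: "awalk u p u" "distinct (tl (pawalk_verts u p))"
    using assms by (auto simp: cycle_def)
  obtain e q where p: "p = e # q"
    using assms(2) by (cases p) auto
  have "apath (snd e) q u" "e \<in> parcs G" "fst e = u"
    using u by (auto simp: p apath_def awalk_Cons_iff)
  moreover have "length q \<ge> 2"
    using assms(2) p by simp
  ultimately show ?thesis
    using recurrent_closed_path[of "snd e" q u] by (metis prod.collapse)
qed

lemma set_rev_path: "set (rev_path p) = (set p)\<inverse>"
  by (induction p) force+

text \<open>Walk to and fro along \<open>p\<close>, turning round only at its two ends.\<close>

lemma recurrent_two_branch_vertices: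
  assumes p: "apath u p v" and "u \<noteq> v"
    and "out_degree (with_proj G) u \<ge> 3" "out_degree (with_proj G) v \<ge> 3"
  shows "recurrent_arcs G (set p \<union> (set p)\<inverse>)"
proof -
  \<comment> \<open>Stated for an arbitrary path \<open>q\<close>, to be used both for
    \<open>p\<close> and for its reverse.\<close>
  have step: "\<exists>z. (b, z) \<in> set q \<union> (set q)\<inverse> \<and> (z \<noteq> a \<or> out_degree (with_proj G) b \<ge> 3)"
    if "apath x q y" "out_degree (with_proj G) y \<ge> 3" "(a, b) \<in> set q" for x y q a b
  proof (cases "b = y")
    case True
    then show ?thesis using that by auto
  next
    case False
    from apath_succ_decomp[OF that(1,3) False] show ?thesis by force
  qed
  have r: "apath v (rev_path p) u"
    using p by simp
  have "set p \<subseteq> parcs G"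
    using p by (auto simp: apath_def)
  moreover have "p \<noteq> []"
    using p \<open>u \<noteq> v\<close> by (auto simp: apath_Nil_iff)
  moreover note step[OF p assms(4)] step[OF r assms(3)]
  ultimately show ?thesis
    unfolding recurrent_arcs_def set_rev_path using arcs_symmetric by fastforce
qed

text \<open>A neighbour \<open>z\<close> of the end \<open>v\<close> off the path would extend it.
  If \<open>z\<close> is on the path, the segment from \<open>z\<close> to \<open>v\<close> closes
  up to a cycle with \<open>(v, z)\<close> unless it is a single arc.\<close>

lemma maximal_apath_last_arc:
  assumes p: "apath u p v" and max: "\<And>x q y. apath x q y \<Longrightarrow> length q \<le> length p"
    and no_rec: "\<nexists>X. recurrent_arcs G X" and vz: "(v, z) \<in> parcs G"
  shows "(z, v) \<in> set p"
proof -
  have aw: "awalk u p v"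
    using p by (rule awalkI_apath)
  have "z \<in> set (pawalk_verts u p)"
  proof (rule ccontr)
    assume "z \<notin> set (pawalk_verts u p)"
    then have "apath u (p @ [(v, z)]) z"
      using p aw vz no_loops'[OF vz] in_arcsD2[OF vz]
      by (auto simp: apath_append_iff apath_simps)
    from max[OF this] show False by simp
  qed
  from awalk_decomp[OF aw this] obtain q r where qr: "p = q @ r" "awalk u q z" "awalk z r v"
    by blast
  then have r: "apath z r v"
    using p by (auto simp: apath_append_iff)
  have "\<not> length r \<ge> 2"
    using recurrent_closed_path[OF r _ vz] no_rec by blast
  moreover have "r \<noteq> []"
    using r no_loops'[OF vz] by (auto simp: apath_Nil_iff)
  ultimately obtain e where "r = [e]"
    by (cases r) (auto simp: not_le)
  with r have "r = [(z, v)]"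
    by (cases e) (auto simp: apath_simps)
  then show ?thesis using qr by simp
qed

text \<open>No arc leaves a longest path, so by connectedness it is the whole graph.\<close>

lemma path_graph_if_degree_le_2:
  assumes conn: "Digraph_Component.connected (with_proj G)"
    and deg: "\<And>v. v \<in> pverts G \<Longrightarrow> out_degree (with_proj G) v < 3"
    and no_rec: "\<nexists>X. recurrent_arcs G X"
  shows "path_graph G"
proof -
  have sc: "strongly_connected (with_proj G)"
    using symmetric_connected_imp_strongly_connected pair_sym_arcs conn by auto
  then obtain x0 where "x0 \<in> pverts G"
    by (auto simp: strongly_connected_def)
  then have "apath x0 [] x0"
    by (simp add: apath_Nil_iff)
  then have "\<exists>u v. apath u [] v"
    by blast
  moreover have "length p < card (pverts G)" if "apath u p v" for u p v
    using that by (rule length_apath_less)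
  ultimately obtain p where "\<exists>u v. apath u p v"
    and max': "\<And>q. \<exists>x y. apath x q y \<Longrightarrow> length q \<le> length p"
    \<comment> \<open>A longest path exists: the empty path at \<open>x0\<close> is one, and path
      lengths are below the number of vertices.\<close>
    using ex_has_greatest_nat[of "\<lambda>p. \<exists>u v. apath u p v" "[]" length "card (pverts G)"] by blast
  then obtain u v where p: "apath u p v" and max: "\<And>x q y. apath x q y \<Longrightarrow> length q \<le> length p"
    by blast
  have aw: "awalk u p v"
    using p by (rule awalkI_apath)
  have r: "apath v (rev_path p) u"
    using p by simp
  have len: "length (rev_path p) = length p"
    by (induction p) auto
  have closed: "(w, z) \<in> set p \<union> (set p)\<inverse>"
    if w: "w \<in> set (pawalk_verts u p)" and wz: "(w, z) \<in> parcs G" for w z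
  proof -
    consider "w = v" | "w = u" | "w \<noteq> u" "w \<noteq> v" by blast
    then show ?thesis
    proof cases
      case 1
      then show ?thesis
        using maximal_apath_last_arc[OF p max no_rec] wz by auto
    next
      case 2
      have "(z, u) \<in> set (rev_path p)"
        using maximal_apath_last_arc[OF r _ no_rec] wz max 2 len by auto
      then show ?thesis using 2 by (auto simp: set_rev_path)
    next
      \<comment> \<open>An inner vertex \<open>w\<close> has a predecessor \<open>x\<close> and a
        different successor \<open>y\<close> on the path; these are already all its neighbours, as
        its degree is at most 2.\<close>
      case 3
      then obtain x where x: "(x, w) \<in> set p"
        using w 3(1) aw awalk_verts_conv'[of u p v] by (cases p) (force simp: awalk_def)+
      then obtain y where y: "(w, y) \<in> set p" "x \<noteq> y"
        using apath_succ_decomp[OF p x 3(2)] by force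
      have "set p \<subseteq> parcs G"
        using aw by auto
      then have "{x, y, z} \<subseteq> {z. (w, z) \<in> parcs G}" "w \<in> pverts G"
        using x y wz arcs_symmetric in_arcsD1 by auto
      with deg[of w] have "card {x, y, z} < 3"
        using card_mono[OF finite_neighbours] by (metis card_neighbours le_less_trans)
      then have "z = x \<or> z = y"
        using y(2) by (auto simp: card_insert_if split: if_splits)
      then show ?thesis using x y by auto
    qed
  qed
  have verts: "w \<in> set (pawalk_verts u p)" if "u \<rightarrow>\<^sup>*\<^bsub>with_proj G\<^esub> w" for w
    using that
  proof (induction rule: reachable_induct)
    case base
    show ?case using hd_in_awalk_verts(1)[OF aw] by simp
  next
    case (step x y)
    then have "(x, y) \<in> set p \<union> (set p)\<inverse>"
      using closed by auto
    then show ?case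
      using awalk_verts_arc1[of _ p u] awalk_verts_arc2[OF aw] by force
  qed
  have "u \<in> pverts G"
    using aw by auto
  then have V: "pverts G = set (pawalk_verts u p)"
    using verts sc aw unfolding strongly_connected_def by auto
  moreover have "parcs G = set p \<union> (set p)\<inverse>"
  proof
    show "parcs G \<subseteq> set p \<union> (set p)\<inverse>"
      using closed V in_arcsD1 by auto
    show "set p \<union> (set p)\<inverse> \<subseteq> parcs G"
      using aw arcs_symmetric by blast
  qed
  ultimately show ?thesis
    using p unfolding path_graph_def by blast
qed

text \<open>Without a recurrent set there is no genuine cycle, so the graph is a tree, and no two
  vertices have degree at least 3. Not being an extended star, it has no such vertex at all, so it
  is a path.\<close>

lemma ex_recurrent_arcs:
  assumes conn: "Digraph_Component.connected (with_proj G)"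
    and "\<not> path_graph G" "\<not> extended_star_graph G"
  shows "\<exists>X. recurrent_arcs G X"
proof (rule ccontr)
  assume no_rec: "\<nexists>X. recurrent_arcs G X"
  have sc: "strongly_connected (with_proj G)"
    using symmetric_connected_imp_strongly_connected pair_sym_arcs conn by auto
  have "tree_graph G"
    using conn recurrent_cycle no_rec unfolding tree_graph_def by blast
  then have not1: "\<nexists>!v. v \<in> pverts G \<and> out_degree (with_proj G) v \<ge> 3"
    using assms(3) unfolding extended_star_graph_def by blast
  have unique: "u = v"
    if "u \<in> pverts G" "v \<in> pverts G"
      "out_degree (with_proj G) u \<ge> 3" "out_degree (with_proj G) v \<ge> 3" for u v
  proof (rule ccontr)
    assume "u \<noteq> v"
    have "u \<rightarrow>\<^sup>*\<^bsub>with_proj G\<^esub> v"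
      using sc that unfolding strongly_connected_def by auto
    then obtain p where "apath u p v"
      using reachable_awalk apath_awalk_to_apath by blast
    from recurrent_two_branch_vertices[OF this \<open>u \<noteq> v\<close> that(3,4)] no_rec show False
      by blast
  qed
  have "out_degree (with_proj G) v < 3" if "v \<in> pverts G" for v
    using that unique not1 by (meson not_le)
  from path_graph_if_degree_le_2[OF conn this no_rec] assms(2) show False
    by blast
qed

end

section \<open>Divisors of the largest admissible number\<close>

text \<open>If a prime \<open>p\<close> had a higher exponent in \<open>n\<close> than in
  \<open>Max S\<close>, replacing its power in \<open>Max S\<close> by the one from \<open>n\<close>
  would give a larger element of \<open>S\<close>.\<close>

lemma max_dvd_closed:
  fixes S :: "nat set"
  assumes fin: "finite S" and pos: "0 \<notin> S"
    and dvd: "\<And>m n. n \<in> S \<Longrightarrow> m dvd n \<Longrightarrow> m \<in> S"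
    and mult: "\<And>m n. m \<in> S \<Longrightarrow> n \<in> S \<Longrightarrow> coprime m n \<Longrightarrow> m * n \<in> S"
    and n: "n \<in> S"
  shows "n dvd Max S"
proof -
  have M: "Max S \<in> S"
    using fin n Max_in by blast
  then have M0: "Max S > 0"
    using pos by (metis gr0I)
  have n0: "n > 0"
    using n pos by (metis gr0I)
  show ?thesis
  proof (rule multiplicity_le_imp_dvd)
    show "n \<noteq> 0" using n0 by simp
    fix p :: nat assume p: "prime p"
    let ?a = "multiplicity p n" and ?b = "multiplicity p (Max S)"
    obtain m where m: "Max S = p ^ ?b * m" "\<not> p dvd m"
      using multiplicity_decompose'[of "Max S" p] M0 p
      by (metis not_prime_unit neq0_conv mult.commute)
    show "?a \<le> ?b"
    proof (rule ccontr)
      assume "\<not> ?a \<le> ?b"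
      \<comment> \<open>Both are divisors of elements of \<open>S\<close>, and they are coprime
        because \<open>m\<close> is the part of \<open>Max S\<close> prime to
        \<open>p\<close>.\<close>
      have "p ^ ?a \<in> S" "m \<in> S"
        using dvd[OF n multiplicity_dvd] dvd[OF M, of m] m(1) by (metis dvd_triv_right)+
      moreover have "coprime (p ^ ?a) m"
        using p m(2) by (simp add: prime_imp_coprime)
      ultimately have "p ^ ?a * m \<le> Max S"
        using mult fin by auto
      moreover have "p ^ ?b < p ^ ?a"
        using \<open>\<not> ?a \<le> ?b\<close> p prime_gt_1_nat by (simp add: power_strict_increasing)
      moreover have "m > 0"
        using m M0 by (metis gr0I mult_0_right)
      ultimately show False
        using m(1) by (metis mult_less_cancel2 not_le)
    qed
  qed
qed

theorem theorem3p1: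
  fixes G :: "'a pair_pre_digraph"
  assumes "pair_graph G"
    and "Digraph_Component.connected (with_proj G)"
    and "\<not> path_graph G"
    and "\<not> extended_star_graph G"
  shows "\<forall>k\<ge>1. circularly_partite G k \<longleftrightarrow> k dvd chi_o G"
proof (intro allI impI)
  fix k :: nat
  interpret pair_graph G by fact
  obtain X where X: "recurrent_arcs G X"
    using ex_recurrent_arcs assms(2-4) by blast
  let ?S = "{k. circularly_partite G k}"
  \<comment> \<open>In terms of labellings, closure under divisors and coprime products no longer
    involves non-empty classes.\<close>
  have S: "k \<in> ?S \<longleftrightarrow> k \<ge> 1 \<and> (\<exists>c. circular_labelling G k c)" for k
  proof (cases "k \<ge> 1")
    case True
    then show ?thesis
      using circularly_partite_iff_labelling[OF X] by simp
  next
    case False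
    then show ?thesis
      by (simp add: circularly_partite_def)
  qed
  have fin: "finite ?S"
    using finite_circularly_partite pair_finite_arcs .
  have dvd: "m \<in> ?S" if "n \<in> ?S" "m dvd n" for m n
  proof -
    have "m \<ge> 1"
      using that unfolding S by (cases m) auto
    then show ?thesis
      using that circular_labelling_dvd unfolding S by blast
  qed
  have mult: "m * n \<in> ?S" if "m \<in> ?S" "n \<in> ?S" "coprime m n" for m n
    using that circular_labelling_mult[of G m _ n] unfolding S by auto
  have "0 \<notin> ?S"
    unfolding S by simp
  have "parcs G \<noteq> {}"
    using X unfolding recurrent_arcs_def by blast
  then have "1 \<in> ?S"
    using circularly_partite_1 by blast
  \<comment> \<open>The maximum is attained, so each divisor of \<open>chi_o G\<close> is admissible
    by \<open>dvd\<close>.\<close>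
  then have "chi_o G \<in> ?S"
    unfolding chi_o_def using Max_in[OF fin] by blast
  show "circularly_partite G k \<longleftrightarrow> k dvd chi_o G"
  proof
    assume "circularly_partite G k"
    then have kS: "k \<in> ?S"
      by simp
    show "k dvd chi_o G"
      unfolding chi_o_def by (rule max_dvd_closed) (fact fin \<open>0 \<notin> ?S\<close> dvd mult kS)+
  next
    assume "k dvd chi_o G"
    from dvd[OF \<open>chi_o G \<in> ?S\<close> this] show "circularly_partite G k"
      by simp
  qed
qed

end
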